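(* For all integers $n\ge 2$: $f(n,2,1)=n$, $f(n,2,2)=\lceil 3n/2\rceil$, $f(n,2,3)=\lceil 9n/4\rceil$, and $f(n,2,4)=3n$.
   Context: For integers $d\ge 1$, $n\ge 1$, the triangular grid is $T_d(n)=\{(x_1,\dots,x_d)\in\mathbb{Z}_{\ge 0}^d : x_1+\dots+x_d\le n-1\}$. A $k$-cover of $T_d(n)$ is a finite multiset of affine hyperplanes in $\mathbb{R}^d$ such that every point of $T_d(n)$ lies in at least $k$ of them (counted with multiplicity). $f(n,d,k)$ is the minimum cardinality (with multiplicity) of a $k$-cover of $T_d(n)$, and $f(n,d)=f(n,d,1)$. For $d=2$ hyperplanes are lines. *)

theory Defs
  imports Complex_Main "HOL-Library.Multiset"
begin

text \<open>Points of R^d are represented as functions nat => real, only coordinates 0..<d matter.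
An affine hyperplane in R^d is given by a pair (a, b) with a normal vector a (nonzero on
coordinates 0..<d, and zero outside them) and offset b; it is the set
{x. sum_{i<d} a i * x i = b}.\<close>

definition is_hyperplane :: "nat \<Rightarrow> (nat \<Rightarrow> real) \<times> real \<Rightarrow> bool" where
  "is_hyperplane d H \<longleftrightarrow> (\<exists>i<d. fst H i \<noteq> 0) \<and> (\<forall>i\<ge>d. fst H i = 0)"

definition on_hyperplane :: "nat \<Rightarrow> (nat \<Rightarrow> real) \<Rightarrow> (nat \<Rightarrow> real) \<times> real \<Rightarrow> bool" where
  "on_hyperplane d x H \<longleftrightarrow> (\<Sum>i<d. fst H i * x i) = snd H"

definition tri_grid :: "nat \<Rightarrow> nat \<Rightarrow> (nat \<Rightarrow> real) set" where
  "tri_grid n d = {x. \<exists>y :: nat \<Rightarrow> nat. (\<forall>i. x i = real (y i)) \<and> (\<forall>i\<ge>d. y i = 0)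
                      \<and> (\<Sum>i<d. y i) + 1 \<le> n}"

definition is_k_cover :: "nat \<Rightarrow> nat \<Rightarrow> nat \<Rightarrow> ((nat \<Rightarrow> real) \<times> real) multiset \<Rightarrow> bool" where
  "is_k_cover n d k M \<longleftrightarrow> (\<forall>H\<in>#M. is_hyperplane d H) \<and>
     (\<forall>x\<in>tri_grid n d. size (filter_mset (on_hyperplane d x) M) \<ge> k)"

definition f_cover :: "nat \<Rightarrow> nat \<Rightarrow> nat \<Rightarrow> nat" where
  "f_cover n d k = (LEAST m. \<exists>M. is_k_cover n d k M \<and> size M = m)"

end

theory Submission
  imports Defs
begin

text \<open>
  Upper bounds come from lines parallel to the sides: such a system is a cover as soon as a
  few sums of its depths are at least \<open>n\<close>.

  For the lower bounds, a side of high multiplicity is removed together with its points. If no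
  side has high multiplicity, the boundary points are counted with their multiplicities; a line
  other than a side meets the boundary at most twice. This settles \<open>k = 1, 2, 4\<close>.

  For \<open>k = 3\<close> one first peels off parallel layers of multiplicity at least 2 from the three sides,
  until an inner triangle of size \<open>m\<close> remains whose sides have multiplicity at most 1. The remaining
  lines still cover the inner triangle three times, and at least once those points of each outer
  side that lie in no peeled layer of the other two sides. Give weight 1 to these outer points and
  to the points on the inner sides, and weight 2 to the inner corners. Every remaining line other
  than an inner side has weight at most 4, because a line that passes through an inner corner and a
  further point of the inner boundary leaves the inner triangle towards a region without outer
  points. Summing up gives exactly \<open>9n / 4\<close>. If some side has no peeled layer, or if \<open>m \<le> 1\<close>,
  it suffices to count the outer and the inner boundary separately.
\<close>

subsection \<open>Lines and triangles in the integer lattice\<close>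

text \<open>\<open>co 0\<close>, \<open>co 1\<close>, \<open>co 2\<close> are homogeneous coordinates with sum 0, in which the three sides of a
  triangle play symmetric roles; \<open>region b\<close> is a triangular grid with \<open>1 - (b 0 + b 1 + b 2)\<close>
  points on each side.\<close>

definition co :: "nat \<Rightarrow> int \<times> int \<Rightarrow> int" where
  "co i P = (if i = 0 then fst P else if i = 1 then snd P else - fst P - snd P)"

definition lev :: "nat \<Rightarrow> int \<Rightarrow> (int \<times> int) set" where
  "lev i t = {P. co i P = t}"

definition region :: "(nat \<Rightarrow> int) \<Rightarrow> (int \<times> int) set" where
  "region b = {P. \<forall>i<3. b i \<le> co i P}"

text \<open>With \<open>t = b i\<close> and \<open>q = p\<close> this is the set of outer points of
  side \<open>i\<close> of \<open>region b\<close>, those beyond the layers peeled off from the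
  other two sides; with \<open>t = p i\<close> it is a side of \<open>region p\<close>.\<close>

definition seg :: "nat \<Rightarrow> int \<Rightarrow> (nat \<Rightarrow> int) \<Rightarrow> (int \<times> int) set" where
  "seg i t q = {P. co i P = t \<and> (\<forall>j<3. j \<noteq> i \<longrightarrow> q j \<le> co j P)}"

text \<open>Twice the signed area of the triangle \<open>P\<close>, \<open>Q\<close>,
  \<open>S\<close>, so it vanishes exactly for collinear points.\<close>

definition orient :: "int \<times> int \<Rightarrow> int \<times> int \<Rightarrow> int \<times> int \<Rightarrow> int" where
  "orient P Q S = (fst Q - fst P) * (snd S - snd P) - (snd Q - snd P) * (fst S - fst P)"

text \<open>The empty set and singletons are included, as a line of the plane may contain at most
  one lattice point.\<close>

definition lattice_line :: "(int \<times> int) set \<Rightarrow> bool" where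
  "lattice_line L \<longleftrightarrow> (\<forall>P\<in>L. \<forall>Q\<in>L. P \<noteq> Q \<longrightarrow> L = {S. orient P Q S = 0})"

text \<open>A multiset of lines is given as a family \<open>L\<close> over the index set
  \<open>J\<close>, so that repeated lines keep their multiplicity.\<close>

definition line_mult :: "'j set \<Rightarrow> ('j \<Rightarrow> (int \<times> int) set) \<Rightarrow> nat \<Rightarrow> int \<Rightarrow> nat" where
  "line_mult J L i t = card {j\<in>J. L j = lev i t}"

definition covers :: "nat \<Rightarrow> 'j set \<Rightarrow> ('j \<Rightarrow> (int \<times> int) set) \<Rightarrow> (int \<times> int) set \<Rightarrow> bool" where
  "covers k J L A \<longleftrightarrow> (\<forall>P\<in>A. k \<le> card {j\<in>J. P \<in> L j})"

lemma less_3: "(i::nat) < 3 \<longleftrightarrow> i = 0 \<or> i = 1 \<or> i = 2"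
  by auto

lemma all_less_3: "(\<forall>i<3. \<phi> i) \<longleftrightarrow> \<phi> 0 \<and> \<phi> 1 \<and> \<phi> (2::nat)"
  by (auto simp: less_3)

lemma sum_less_3: "(\<Sum>i<3. \<phi> i) = \<phi> 0 + \<phi> 1 + \<phi> (2::nat)"
  by (simp add: numeral_3_eq_3 numeral_2_eq_2)

lemma co_simps [simp]: "co 0 P = fst P" "co (Suc 0) P = snd P" "co 2 P = - fst P - snd P"
  by (simp_all add: co_def)

lemma sum_co: "(\<Sum>i<3. co i P) = 0"
  by (simp add: sum_less_3)

lemma lev_eq_iff:
  assumes "i < 3" "j < 3"
  shows "lev i s = lev j t \<longleftrightarrow> i = j \<and> s = t"
proof
  assume eq: "lev i s = lev j t"
  have mem: "co i P = s \<longleftrightarrow> co j P = t" for P using eq by (auto simp: lev_def)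
  consider "i = j" | "{i, j} = {0, 1}" | "{i, j} = {0, 2}" | "{i, j} = {1, 2}"
    using assms by (auto simp: less_3)
  then show "i = j \<and> s = t"
  proof cases
    case 1
    then show ?thesis using mem[of "(s, 0)"] mem[of "(0, s)"] mem[of "(0, - s)"] assms(1) by (auto simp: less_3)
  next
    case 2
    \<comment> \<open>For each order of \<open>i\<close> and \<open>j\<close> the test point has
      \<open>co i P = s\<close> but \<open>co j P = t + 1\<close>.\<close>
    then show ?thesis using mem[of "(s, t + 1)"] mem[of "(t + 1, s)"] by (auto simp: doubleton_eq_iff)
  next
    case 3
    then show ?thesis using mem[of "(s, - s - t - 1)"] mem[of "(t + 1, - s - t - 1)"] by (auto simp: doubleton_eq_iff)
  next
    case 4
    then show ?thesis using mem[of "(- s - t - 1, s)"] mem[of "(- s - t - 1, t + 1)"] by (auto simp: doubleton_eq_iff)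
  qed
qed auto

lemma orient_lev:
  assumes "P \<noteq> Q" "co i P = t" "co i Q = t"
  shows "{S. orient P Q S = 0} = lev i t"
proof -
  obtain a b c d where [simp]: "P = (a, b)" "Q = (c, d)" by (cases P, cases Q) auto
  consider "i = 0" | "i = 1" | "i \<noteq> 0" "i \<noteq> 1" by auto
  then show ?thesis
  proof cases
    case 3
    have h: "b = - t - a" "d = - t - c" using assms 3 by (auto simp: co_def)
    have "orient P Q S = (c - a) * (fst S + snd S + t)" for S
      by (simp add: orient_def h algebra_simps)
    moreover have "c \<noteq> a" using assms h by auto
    ultimately show ?thesis using 3 by (auto simp: lev_def co_def)
  qed (use assms in \<open>auto simp: orient_def lev_def co_def\<close>)
qed

lemma lattice_line_eq_lev:
  assumes "lattice_line L" "P \<in> L" "Q \<in> L" "P \<noteq> Q" "co i P = t" "co i Q = t"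
  shows "L = lev i t"
proof -
  have "L = {S. orient P Q S = 0}" using assms unfolding lattice_line_def by blast
  then show ?thesis using orient_lev assms by metis
qed

lemma lattice_line_orient:
  assumes "lattice_line L" "P \<in> L" "Q \<in> L" "S \<in> L"
  shows "orient P Q S = 0"
proof (cases "P = Q")
  case False
  then have "L = {S. orient P Q S = 0}" using assms unfolding lattice_line_def by blast
  then show ?thesis using assms by auto
qed (simp add: orient_def)

lemma card_Int_line_le_1:
  assumes "lattice_line L" "L \<noteq> lev i t" "A \<subseteq> lev i t"
  shows "card (A \<inter> L) \<le> 1"
proof -
  have "P = Q" if "P \<in> A \<inter> L" "Q \<in> A \<inter> L" for P Q
    using lattice_line_eq_lev[OF assms(1), of P Q i t] that assms by (auto simp: lev_def)
  \<comment> \<open>An infinite intersection is harmless because its \<open>card\<close> is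
    0.\<close>
  then show ?thesis
    by (cases "finite (A \<inter> L)") (simp_all add: card_le_Suc0_iff_eq)
qed

lemma seg_subset_lev: "seg i t q \<subseteq> lev i t"
  by (auto simp: seg_def lev_def)

text \<open>On the segment the other two coordinates sum to \<open>- t\<close>, so one of them runs
  through an integer interval and determines the point. The maximum with 0 accounts for an empty
  interval.\<close>

lemma finite_seg: "i < 3 \<Longrightarrow> finite (seg i t q)"
  and card_seg: "i < 3 \<Longrightarrow> int (card (seg i t q)) = max 0 (1 - t - ((\<Sum>j<3. q j) - q i))"
proof -
  have 0: "seg 0 t q = (\<lambda>y. (t, y)) ` {q 1..- t - q 2}"
    by (auto simp: seg_def all_less_3 image_iff)
  have 1: "seg 1 t q = (\<lambda>x. (x, t)) ` {q 0..- t - q 2}"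
    by (auto simp: seg_def all_less_3 image_iff)
  have 2: "seg 2 t q = (\<lambda>x. (x, - t - x)) ` {q 0..- t - q 1}"
    by (auto simp: seg_def all_less_3 image_iff)
  show "i < 3 \<Longrightarrow> finite (seg i t q)" using 0 1 2 by (auto simp: less_3)
  have "int (card (seg 0 t q)) = max 0 (1 - t - q 1 - q 2)"
    unfolding 0 by (subst card_image) (auto simp: inj_on_def)
  moreover have "int (card (seg 1 t q)) = max 0 (1 - t - q 0 - q 2)"
    unfolding 1 by (subst card_image) (auto simp: inj_on_def)
  moreover have "int (card (seg 2 t q)) = max 0 (1 - t - q 0 - q 1)"
    unfolding 2 by (subst card_image) (auto simp: inj_on_def)
  ultimately show "i < 3 \<Longrightarrow> int (card (seg i t q)) = max 0 (1 - t - ((\<Sum>j<3. q j) - q i))"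
    by (auto simp: less_3 sum_less_3)
qed

text \<open>Two points of \<open>L\<close> on the same side would make \<open>L\<close> that side.
  So \<open>P\<close>, \<open>Q\<close>, \<open>S\<close> lie in the relative interiors of three
  different sides, and then \<open>orient P Q S\<close> is positive.\<close>

lemma triangle_sides_not_collinear:
  fixes b :: "nat \<Rightarrow> int"
  assumes line: "lattice_line L" "\<And>i. i < 3 \<Longrightarrow> L \<noteq> lev i (b i)"
    and PQS: "P \<in> L" "Q \<in> L" "S \<in> L" "P \<in> region b" "Q \<in> region b" "S \<in> region b"
    and on: "co 0 P = b 0" "co 1 Q = b 1" "co 2 S = b 2"
    and ne: "P \<noteq> Q" "Q \<noteq> S" "P \<noteq> S"
  shows False
proof -
  have no: "\<not> (co i U = b i \<and> co i V = b i)" if "i < 3" "U \<in> L" "V \<in> L" "U \<noteq> V" for i U V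
    using lattice_line_eq_lev[OF line(1)] line(2) that by blast
  \<comment> \<open>These are offsets from the corner of sides 0 and 1; \<open>N\<close> is the
    number of lattice steps along a side.\<close>
  define p1 q0 s0 s1 where "p1 = snd P - b 1" "q0 = fst Q - b 0" "s0 = fst S - b 0" "s1 = snd S - b 1"
  define N where "N = - b 0 - b 1 - b 2"
  have pos: "p1 > 0" "q0 > 0" "s0 > 0" "s1 > 0" "p1 < N" "q0 < N"
    using no[of 1 P Q] no[of 2 P S] no[of 0 Q P] no[of 2 Q S] no[of 0 S P] no[of 1 S Q] PQS on ne
    by (auto simp: p1_q0_s0_s1_def N_def region_def all_less_3)
  have s0: "s0 = N - s1" using on by (simp add: p1_q0_s0_s1_def N_def)
  have "orient P Q S = q0 * (s1 - p1) + p1 * s0"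
    using on by (simp add: orient_def p1_q0_s0_s1_def algebra_simps)
  then have eq: "q0 * (s1 - p1) + p1 * s0 = 0"
    using lattice_line_orient[OF line(1) PQS(1-3)] by simp
  show False
  proof (cases "p1 \<le> s1")
    case True
    then have "0 \<le> q0 * (s1 - p1)" "0 < p1 * s0" using pos by auto
    then show False using eq by linarith
  next
    case False
    \<comment> \<open>With \<open>s0 = N - s1\<close> the orientation regroups into
      \<open>s1 * (N - p1)\<close>, which is positive, and \<open>(N - q0) * (p1 - s1)\<close>,
      which is nonnegative.\<close>
    have "N * (p1 - s1) \<ge> q0 * (p1 - s1)" using pos False by (intro mult_right_mono) auto
    moreover have "s1 * (N - p1) > 0" using pos by auto
    moreover have "q0 * (s1 - p1) + p1 * s0 = s1 * (N - p1) + (N * (p1 - s1) - q0 * (p1 - s1))"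
      by (simp add: s0 algebra_simps)
    ultimately show False using eq by linarith
  qed
qed

text \<open>Each side contributes at most one point. Disjointness keeps a corner from being counted
  twice, so three contributions would be three distinct collinear points on the three sides.\<close>

lemma sum_card_sides_le_2:
  fixes b :: "nat \<Rightarrow> int"
  assumes line: "lattice_line L" "\<And>i. i < 3 \<Longrightarrow> L \<noteq> lev i (b i)"
    and A: "\<And>i. i < 3 \<Longrightarrow> A i \<subseteq> lev i (b i)" "\<And>i. i < 3 \<Longrightarrow> A i \<subseteq> region b"
    and disj: "A 0 \<inter> A 1 = {}" "A 0 \<inter> A 2 = {}" "A 1 \<inter> A (2::nat) = {}"
  shows "(\<Sum>i<3. card (A i \<inter> L)) \<le> 2"
proof (rule ccontr)
  assume "\<not> ?thesis"
  then have sum: "card (A 0 \<inter> L) + card (A 1 \<inter> L) + card (A 2 \<inter> L) > 2" by (simp add: sum_less_3)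
  have le: "card (A i \<inter> L) \<le> 1" if "i < 3" for i
    by (rule card_Int_line_le_1[OF line(1) line(2)[OF that] A(1)[OF that]])
  have "card (A 0 \<inter> L) \<noteq> 0" "card (A 1 \<inter> L) \<noteq> 0" "card (A 2 \<inter> L) \<noteq> 0"
    using sum le[of 0] le[of 1] le[of 2] by auto
  then obtain P Q S where PQS: "P \<in> A 0 \<inter> L" "Q \<in> A 1 \<inter> L" "S \<in> A 2 \<inter> L"
    by (metis card.empty ex_in_conv)
  have lv: "co 0 P = b 0" "co 1 Q = b 1" "co 2 S = b 2"
    using PQS A(1)[of 0] A(1)[of 1] A(1)[of 2] by (auto simp: lev_def)
  show False
    by (rule triangle_sides_not_collinear[OF line _ _ _ _ _ _ lv])
      (use PQS disj A(2)[of 0] A(2)[of 1] A(2)[of 2] in auto)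
qed

lemma double_count:
  assumes "finite J" "finite A" "covers k J L A"
  shows "k * card A \<le> (\<Sum>j\<in>J. card (A \<inter> L j))"
proof -
  have "k * card A = (\<Sum>P\<in>A. k)" by simp
  also have "\<dots> \<le> (\<Sum>P\<in>A. card {j\<in>J. P \<in> L j})"
    using assms(3) by (intro sum_mono) (auto simp: covers_def)
  also have "\<dots> = (\<Sum>P\<in>A. \<Sum>j\<in>J. if P \<in> L j then 1 else 0)"
    using assms by (intro sum.cong refl) (simp add: sum.If_cases Int_def)
  also have "\<dots> = (\<Sum>j\<in>J. \<Sum>P\<in>A. if P \<in> L j then 1 else 0)"
    by (rule sum.swap)
  also have "\<dots> = (\<Sum>j\<in>J. card (A \<inter> L j))"
    using assms by (intro sum.cong refl) (simp add: sum.If_cases)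
  finally show ?thesis .
qed

lemma sum_of_bool_line: "finite J \<Longrightarrow> (\<Sum>j\<in>J. of_bool (L j = lev i t) * c) = int (line_mult J L i t) * c"
  by (simp add: line_mult_def sum_distrib_right[symmetric] Int_def)

subsection \<open>Counting boundary points\<close>

lemma finite_region: "finite (region b)"
proof (rule finite_subset)
  show "region b \<subseteq> {b 0..- b 1 - b 2} \<times> {b 1..- b 0 - b 2}"
    by (auto simp: region_def all_less_3)
qed simp

lemma covers_subset: "covers k J L A \<Longrightarrow> B \<subseteq> A \<Longrightarrow> covers k J L B"
  by (auto simp: covers_def)

text \<open>The lines equal to side \<open>i\<close> miss the smaller triangle, so it stays covered
  \<open>k\<close> times without them.\<close>

lemma remove_side:
  assumes "finite J" "i < 3" "covers k J L (region b)"
  obtains J' where "J' \<subseteq> J" "covers k J' L (region (b(i := b i + 1)))"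
    "card J' + line_mult J L i (b i) = card J"
proof
  let ?J = "{j\<in>J. L j \<noteq> lev i (b i)}"
  show "?J \<subseteq> J" by auto
  show "covers k ?J L (region (b(i := b i + 1)))"
    unfolding covers_def
  proof
    fix P assume P: "P \<in> region (b(i := b i + 1))"
    then have "P \<in> region b" using assms(2) by (force simp: region_def split: if_splits)
    then have "k \<le> card {j\<in>J. P \<in> L j}" using assms(3) by (auto simp: covers_def)
    moreover have "P \<notin> lev i (b i)" using P assms(2) by (auto simp: region_def lev_def)
    then have "{j\<in>J. P \<in> L j} = {j\<in>?J. P \<in> L j}" by auto
    ultimately show "k \<le> card {j\<in>?J. P \<in> L j}" by simp
  qed
  have "card (?J \<union> {j\<in>J. L j = lev i (b i)}) = card ?J + line_mult J L i (b i)"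
    unfolding line_mult_def using assms(1) by (intro card_Un_disjoint) auto
  then show "card ?J + line_mult J L i (b i) = card J"
    by (smt (verit) Collect_cong Un_def mem_Collect_eq Collect_mem_eq)
qed

text \<open>A side of multiplicity at least \<open>c / r\<close> can be removed together with the grid points on it.\<close>

lemma lower_bound_by_removing_sides:
  fixes c r :: int and b :: "nat \<Rightarrow> int"
  assumes step: "\<And>(J :: 'j set) b. finite J \<Longrightarrow> \<forall>j\<in>J. lattice_line (L j) \<Longrightarrow> covers k J L (region b) \<Longrightarrow>
      (\<Sum>i<3. b i) \<le> 0 \<Longrightarrow> \<forall>i<3. r * int (line_mult J L i (b i)) < c \<Longrightarrow>
      c * (1 - (\<Sum>i<3. b i)) \<le> r * int (card J)"
    and "finite J" "\<forall>j\<in>J. lattice_line (L j)" "covers k J L (region b)" "(\<Sum>i<3. b i) \<le> 1" "0 \<le> r"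
  shows "c * (1 - (\<Sum>i<3. b i)) \<le> r * int (card J)"
  using assms(2-5)
proof (induction "nat (1 - (\<Sum>i<3. b i))" arbitrary: J b)
  case 0
  then show ?case using assms(6) by simp
next
  case (Suc m)
  show ?case
  proof (cases "\<forall>i<3. r * int (line_mult J L i (b i)) < c")
    case True
    moreover have "(\<Sum>i<3. b i) \<le> 0" using Suc(2) by linarith
    ultimately show ?thesis using step[OF Suc(3-5)] by blast
  next
    case False
    then obtain i where i: "i < 3" "c \<le> r * int (line_mult J L i (b i))" by force
    obtain J' where J': "J' \<subseteq> J" "covers k J' L (region (b(i := b i + 1)))"
      "card J' + line_mult J L i (b i) = card J"
      using remove_side[OF Suc(3) i(1) Suc(5)] .
    have sum: "(\<Sum>j<3. (b(i := b i + 1)) j) = (\<Sum>j<3. b j) + 1"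
      using i(1) by (auto simp: less_3 sum_less_3)
    have "c * (1 - (\<Sum>j<3. (b(i := b i + 1)) j)) \<le> r * int (card J')"
    proof (rule Suc(1))
      show "m = nat (1 - (\<Sum>j<3. (b(i := b i + 1)) j))" "(\<Sum>j<3. (b(i := b i + 1)) j) \<le> 1"
        unfolding sum using Suc(2) by linarith+
      show "finite J'" "\<forall>j\<in>J'. lattice_line (L j)" using Suc(3,4) J'(1) finite_subset by auto
      show "covers k J' L (region (b(i := b i + 1)))" by (rule J'(2))
    qed
    then have "c * (1 - (\<Sum>j<3. b j)) - c \<le> r * int (card J')"
      unfolding sum by (simp add: algebra_simps)
    moreover have "r * int (card J) = r * int (card J') + r * int (line_mult J L i (b i))"
      unfolding J'(3)[symmetric] by (simp add: algebra_simps)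
    ultimately show ?thesis using i(2) by linarith
  qed
qed

text \<open>One end point is left out of each side, so that every corner is counted once.\<close>

definition half_open_side :: "(nat \<Rightarrow> int) \<Rightarrow> nat \<Rightarrow> (int \<times> int) set" where
  "half_open_side b i = seg i (b i) (\<lambda>j. if j = (i + 1) mod 3 then b j + 1 else b j)"

lemma half_open_side_simps:
  "half_open_side b 0 = {P. co 0 P = b 0 \<and> b 1 < co 1 P \<and> b 2 \<le> co 2 P}"
  "half_open_side b (Suc 0) = {P. co 1 P = b 1 \<and> b 2 < co 2 P \<and> b 0 \<le> co 0 P}"
  "half_open_side b 2 = {P. co 2 P = b 2 \<and> b 0 < co 0 P \<and> b 1 \<le> co 1 P}"
  by (auto simp: half_open_side_def seg_def all_less_3)

lemma half_open_side_subset_region: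
  assumes "i < 3"
  shows "half_open_side b i \<subseteq> region b"
proof -
  consider "i = 0" | "i = 1" | "i = 2" using assms by (auto simp: less_3)
  then show ?thesis by cases (auto simp: half_open_side_simps region_def all_less_3)
qed

lemma card_half_open_side:
  assumes "i < 3" "(\<Sum>i<3. b i) \<le> 0"
  shows "int (card (half_open_side b i)) = - (\<Sum>i<3. b i)"
proof -
  consider "i = 0" | "i = 1" | "i = 2" using assms(1) by (auto simp: less_3)
  then show ?thesis
    unfolding half_open_side_def card_seg[OF assms(1)] using assms(2)
    by cases (simp_all add: sum_less_3)
qed

text \<open>With \<open>N = - (\<Sum>i<3. b i)\<close>, a side line contains the \<open>N\<close>
  points of its own half-open side and the corner left out there, which belongs to a neighbouring
  side: in total \<open>N + 1 = 2 + (N - 1)\<close>.\<close>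

lemma half_open_sides_Int_line:
  fixes b :: "nat \<Rightarrow> int"
  assumes line: "lattice_line L" and b: "(\<Sum>i<3. b i) \<le> -1"
  shows "(\<Sum>i<3. int (card (half_open_side b i \<inter> L)))
     \<le> 2 + (\<Sum>i<3. of_bool (L = lev i (b i)) * (- (\<Sum>i<3. b i) - 1))"
proof (cases "\<exists>i<3. L = lev i (b i)")
  case False
  have "(\<Sum>i<3. card (half_open_side b i \<inter> L)) \<le> 2"
  proof (rule sum_card_sides_le_2[OF line])
    show "half_open_side b i \<subseteq> lev i (b i)" for i
      by (simp add: half_open_side_def seg_subset_lev)
    show "half_open_side b i \<subseteq> region b" if "i < 3" for i
      by (rule half_open_side_subset_region[OF that])
  qed (use False in \<open>auto simp: half_open_side_simps\<close>)
  then show ?thesis using False by (simp add: of_nat_sum[symmetric] del: of_nat_sum)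
next
  case True
  then obtain i where i: "i < 3" "L = lev i (b i)" by blast
  have le: "card (half_open_side b j \<inter> L) \<le> 1" if "j < 3" "j \<noteq> i" for j
    using that i by (intro card_Int_line_le_1[OF line, of j "b j"])
      (simp_all add: lev_eq_iff half_open_side_def seg_subset_lev)
  have own: "half_open_side b i \<inter> L = half_open_side b i"
    using i(2) by (auto simp: half_open_side_def seg_def lev_def)
  have "card (half_open_side b i) = - (\<Sum>i<3. b i)"
    using card_half_open_side[OF i(1), of b] b by linarith
  \<comment> \<open>The end point left out of this neighbouring half-open side is exactly its corner
    with side \<open>i\<close>.\<close>
  moreover have "i = 0 \<Longrightarrow> half_open_side b 2 \<inter> L = {}" "i = 1 \<Longrightarrow> half_open_side b 0 \<inter> L = {}"
    "i = 2 \<Longrightarrow> half_open_side b 1 \<inter> L = {}"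
    using i(2) by (auto simp: half_open_side_simps lev_def)
  ultimately have "(\<Sum>j<3. int (card (half_open_side b j \<inter> L))) \<le> 1 - (\<Sum>i<3. b i)"
    using le[of 0] le[of 1] le[of 2] own \<open>i < 3\<close>
    unfolding less_3 sum_less_3 by (elim disjE) simp_all
  moreover have "(\<Sum>j<3. of_bool (L = lev j (b j)) * (- (\<Sum>i<3. b i) - 1)) = - (\<Sum>i<3. b i) - 1"
    using i by (auto simp: less_3 sum_less_3 lev_eq_iff)
  ultimately show ?thesis by linarith
qed

text \<open>The boundary has \<open>3 * N\<close> points, each covered \<open>k\<close> times; a
  line supplies at most 2 incidences, and a side line \<open>N - 1\<close> more.\<close>

lemma boundary_count:
  fixes b :: "nat \<Rightarrow> int"
  assumes J: "finite J" "\<forall>j\<in>J. lattice_line (L j)" "covers k J L (region b)"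
    and b: "(\<Sum>i<3. b i) \<le> -1"
  defines "N \<equiv> - (\<Sum>i<3. b i)"
  shows "3 * int k * N \<le> 2 * int (card J) + (\<Sum>i<3. int (line_mult J L i (b i))) * (N - 1)"
proof -
  have "int k * N \<le> (\<Sum>j\<in>J. int (card (half_open_side b i \<inter> L j)))" if i: "i < 3" for i
  proof -
    note sub = half_open_side_subset_region[OF i, of b]
    have "k * card (half_open_side b i) \<le> (\<Sum>j\<in>J. card (half_open_side b i \<inter> L j))"
      by (rule double_count[OF J(1) finite_subset[OF sub finite_region] covers_subset[OF J(3) sub]])
    then have "int k * int (card (half_open_side b i)) \<le> (\<Sum>j\<in>J. int (card (half_open_side b i \<inter> L j)))"
      by (metis of_nat_le_iff of_nat_mult of_nat_sum)
    then show ?thesis using card_half_open_side[OF i, of b] b by (simp add: N_def)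
  qed
  from this[of 0] this[of 1] this[of 2]
  have "3 * int k * N \<le> (\<Sum>i<3. \<Sum>j\<in>J. int (card (half_open_side b i \<inter> L j)))"
    by (simp add: sum_less_3)
  also have "\<dots> = (\<Sum>j\<in>J. \<Sum>i<3. int (card (half_open_side b i \<inter> L j)))"
    by (rule sum.swap)
  also have "\<dots> \<le> (\<Sum>j\<in>J. 2 + (\<Sum>i<3. of_bool (L j = lev i (b i)) * (N - 1)))"
    unfolding N_def using half_open_sides_Int_line[OF _ b] J(2) by (intro sum_mono) blast
  also have "\<dots> = 2 * int (card J) + (\<Sum>i<3. int (line_mult J L i (b i)) * (N - 1))"
    unfolding sum.distrib sum.swap[of _ "{..<3}" J] sum_of_bool_line[OF J(1)] by simp
  finally show ?thesis by (simp add: sum_distrib_right)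
qed

section \<open>Lower bounds for covers of multiplicity 1, 2 and 4\<close>

lemma covers_nonempty:
  assumes "finite J" "covers k J L (region b)" "(\<Sum>i<3. b i) \<le> 0"
  shows "k \<le> card J"
proof -
  have "(b 0, b 1) \<in> region b" using assms(3) by (simp add: region_def all_less_3 sum_less_3)
  then have "k \<le> card {j\<in>J. (b 0, b 1) \<in> L j}" using assms(2) by (auto simp: covers_def)
  also have "\<dots> \<le> card J" using assms(1) by (auto intro: card_mono)
  finally show ?thesis .
qed

text \<open>Sides that occur as lines are removed. If none occurs, every line meets side 0 at most
  once, and that side has \<open>1 - (\<Sum>i<3. b i)\<close> points.\<close>

lemma lower_bound_1:
  assumes "finite J" "\<forall>j\<in>J. lattice_line (L j)" "covers 1 J L (region b)" "(\<Sum>i<3. b i) \<le> 1"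
  shows "1 - (\<Sum>i<3. b i) \<le> int (card J)"
proof -
  have "1 * (1 - (\<Sum>i<3. b i)) \<le> 1 * int (card J)"
  proof (rule lower_bound_by_removing_sides[OF _ assms])
    fix J :: "'a set" and b
    assume J: "finite J" "\<forall>j\<in>J. lattice_line (L j)" "covers 1 J L (region b)" and b: "(\<Sum>i<3. b i) \<le> 0"
      and m: "\<forall>i<3. 1 * int (line_mult J L i (b i)) < 1"
    have sub: "seg 0 (b 0) b \<subseteq> region b" by (auto simp: seg_def region_def all_less_3)
    have "{j\<in>J. L j = lev 0 (b 0)} = {}" using m J(1) by (auto simp: line_mult_def)
    then have "card (seg 0 (b 0) b \<inter> L j) \<le> 1" if "j \<in> J" for j
      using that J by (intro card_Int_line_le_1[where i = 0 and t = "b 0"]) (auto simp: seg_subset_lev)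
    then have "(\<Sum>j\<in>J. card (seg 0 (b 0) b \<inter> L j)) \<le> (\<Sum>j\<in>J. 1)" by (intro sum_mono) auto
    then have "card (seg 0 (b 0) b) \<le> card J"
      using double_count[OF J(1) finite_seg covers_subset[OF J(3) sub]] by simp
    then show "1 * (1 - (\<Sum>i<3. b i)) \<le> 1 * int (card J)"
      using card_seg[of 0 "b 0" b] b by simp
  qed simp
  then show ?thesis by simp
qed

text \<open>Treats \<open>k = 2\<close> and \<open>k = 4\<close> together. Sides of multiplicity at
  least \<open>3 * h / 2\<close> are removed; otherwise the boundary count gives
  \<open>6 * h * N \<le> 2 * card J + 3 * h * (N - 1)\<close>.\<close>

lemma lower_bound_even:
  assumes h: "h \<le> 2" and "finite J" "\<forall>j\<in>J. lattice_line (L j)" "covers (2 * h) J L (region b)"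
    "(\<Sum>i<3. b i) \<le> 1"
  shows "3 * int h * (1 - (\<Sum>i<3. b i)) \<le> 2 * int (card J)"
proof (rule lower_bound_by_removing_sides[OF _ assms(2-5)])
  fix J :: "'a set" and b
  assume J: "finite J" "\<forall>j\<in>J. lattice_line (L j)" "covers (2 * h) J L (region b)" and b: "(\<Sum>i<3. b i) \<le> 0"
    and m: "\<forall>i<3. 2 * int (line_mult J L i (b i)) < 3 * int h"
  show "3 * int h * (1 - (\<Sum>i<3. b i)) \<le> 2 * int (card J)"
  \<comment> \<open>The boundary count requires at least two points on a side; a single point needs
    \<open>2 * h\<close> lines anyway.\<close>
  proof (cases "(\<Sum>i<3. b i) = 0")
    case True
    then show ?thesis using covers_nonempty[OF J(1,3) b] by simp
  next
    case False
    define N where "N = - (\<Sum>i<3. b i)"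
    have N: "N \<ge> 1" using False b by (simp add: N_def)
    have "3 * int (2 * h) * N \<le> 2 * int (card J) + (\<Sum>i<3. int (line_mult J L i (b i))) * (N - 1)"
      unfolding N_def by (rule boundary_count[OF J]) (use N in \<open>simp add: N_def\<close>)
    \<comment> \<open>For \<open>h \<le> 2\<close> an integer below \<open>3 * h / 2\<close> is at
      most \<open>h\<close>.\<close>
    moreover have "int (line_mult J L i (b i)) \<le> int h" if "i < 3" for i
      using m[rule_format, OF that] h by linarith
    then have "(\<Sum>i<3. int (line_mult J L i (b i))) \<le> 3 * int h"
      using sum_mono[of "{..<3}" "\<lambda>i. int (line_mult J L i (b i))" "\<lambda>_. int h"] by simp
    then have "(\<Sum>i<3. int (line_mult J L i (b i))) * (N - 1) \<le> 3 * int h * (N - 1)"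
      using N by (intro mult_right_mono) auto
    moreover have "(\<Sum>i<3. b i) = - N" by (simp add: N_def)
    ultimately show ?thesis by (simp add: algebra_simps)
  qed
qed simp

subsection \<open>Peeling off layers\<close>

text \<open>Here \<open>b\<close> bounds the original triangle and \<open>p\<close> the inner one
  left after cutting off \<open>p i - b i\<close> levels from side \<open>i\<close>.\<close>

definition in_layers :: "(nat \<Rightarrow> int) \<Rightarrow> (nat \<Rightarrow> int) \<Rightarrow> (int \<times> int) set \<Rightarrow> bool" where
  "in_layers b p X \<longleftrightarrow> (\<exists>i<3. \<exists>t. b i \<le> t \<and> t < p i \<and> X = lev i t)"

definition peel :: "'j set \<Rightarrow> ('j \<Rightarrow> (int \<times> int) set) \<Rightarrow> (nat \<Rightarrow> int) \<Rightarrow> (nat \<Rightarrow> int) \<Rightarrow> 'j set" where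
  "peel J L b p = {j\<in>J. \<not> in_layers b p (L j)}"

lemma peel_subset: "peel J L b p \<subseteq> J"
  by (auto simp: peel_def)

lemma peel_self: "peel J L b b = J"
  by (auto simp: peel_def in_layers_def)

lemma card_peel_step:
  assumes "finite J" "i < 3" "b i \<le> p i"
  shows "card (peel J L b (p(i := p i + 1))) + line_mult (peel J L b p) L i (p i) = card (peel J L b p)"
proof -
  have layers: "in_layers b (p(i := p i + 1)) X \<longleftrightarrow> in_layers b p X \<or> X = lev i (p i)" for X
  proof
    assume "in_layers b (p(i := p i + 1)) X"
    then obtain k t where k: "k < 3" "b k \<le> t" "t < (p(i := p i + 1)) k" "X = lev k t"
      unfolding in_layers_def by blast
    then have "k = i \<and> t = p i \<or> t < p k" by (auto split: if_splits)
    then show "in_layers b p X \<or> X = lev i (p i)" using k unfolding in_layers_def by blast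
  next
    assume "in_layers b p X \<or> X = lev i (p i)"
    then show "in_layers b (p(i := p i + 1)) X"
    proof
      assume "in_layers b p X"
      then obtain k t where "k < 3" "b k \<le> t" "t < p k" "X = lev k t"
        unfolding in_layers_def by blast
      then show ?thesis unfolding in_layers_def by (intro exI[of _ k]) auto
    next
      assume "X = lev i (p i)"
      then show ?thesis using assms unfolding in_layers_def by (intro exI[of _ i]) auto
    qed
  qed
  have fin: "finite (peel J L b p)" using assms(1) peel_subset finite_subset by metis
  have "peel J L b p = peel J L b (p(i := p i + 1)) \<union> {j\<in>peel J L b p. L j = lev i (p i)}"
    by (auto simp: peel_def layers)
  also have "card \<dots> = card (peel J L b (p(i := p i + 1))) + line_mult (peel J L b p) L i (p i)"
    unfolding line_mult_def
  proof (rule card_Un_disjoint)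
    show "finite (peel J L b (p(i := p i + 1)))" using assms(1) peel_subset finite_subset by metis
    show "finite {j\<in>peel J L b p. L j = lev i (p i)}" using fin by simp
  qed (auto simp: peel_def layers)
  finally show ?thesis ..
qed

lemma covers_peel_region:
  assumes "covers k J L (region b)" "\<forall>i<3. b i \<le> p i"
  shows "covers k (peel J L b p) L (region p)"
  unfolding covers_def
proof
  fix P assume P: "P \<in> region p"
  then have "P \<in> region b" using assms(2) by (force simp: region_def)
  then have "k \<le> card {j\<in>J. P \<in> L j}" using assms(1) by (auto simp: covers_def)
  moreover have "\<not> in_layers b p X" if "P \<in> X" for X
    using that P by (auto simp: in_layers_def region_def lev_def)
  then have "{j\<in>J. P \<in> L j} = {j\<in>peel J L b p. P \<in> L j}" by (auto simp: peel_def)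
  ultimately show "k \<le> card {j\<in>peel J L b p. P \<in> L j}" by simp
qed

lemma seg_subset_region:
  assumes "i < 3" "\<forall>i<3. b i \<le> p i"
  shows "seg i (b i) p \<subseteq> region b"
proof
  fix P assume P: "P \<in> seg i (b i) p"
  have "b j \<le> co j P" if "j < 3" for j
    using P assms(2) that by (cases "j = i") (auto simp: seg_def intro: order_trans)
  then show "P \<in> region b" by (simp add: region_def)
qed

text \<open>An outer point of side \<open>i\<close> lies beyond the layers of the other two sides,
  so the only peeled line that can pass through it is the side itself.\<close>

lemma covers_peel_side:
  assumes "finite J" "covers k J L (region b)" "\<forall>i<3. b i \<le> p i" "i < 3"
    and "line_mult J L i (b i) \<le> m"
  shows "covers (k - m) (peel J L b p) L (seg i (b i) p)"
  unfolding covers_def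
proof
  fix P assume P: "P \<in> seg i (b i) p"
  have "X = lev i (b i)" if X: "P \<in> X" "in_layers b p X" for X
  proof -
    obtain k t where k: "k < 3" "b k \<le> t" "t < p k" "X = lev k t"
      using X(2) unfolding in_layers_def by blast
    then have "co k P = t" using X(1) by (simp add: lev_def)
    then show ?thesis using P k by (cases "k = i") (auto simp: seg_def)
  qed
  then have "{j\<in>J. P \<in> L j} \<subseteq> {j\<in>peel J L b p. P \<in> L j} \<union> {j\<in>J. L j = lev i (b i)}"
    by (auto simp: peel_def)
  moreover have fin: "finite (peel J L b p)" using assms(1) peel_subset finite_subset by metis
  ultimately have "card {j\<in>J. P \<in> L j} \<le> card ({j\<in>peel J L b p. P \<in> L j} \<union> {j\<in>J. L j = lev i (b i)})"
    using assms(1) by (intro card_mono) auto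
  also have "\<dots> \<le> card {j\<in>peel J L b p. P \<in> L j} + m"
    using order_trans[OF card_Un_le add_left_mono[OF assms(5)[unfolded line_mult_def]]] .
  finally have "card {j\<in>J. P \<in> L j} \<le> card {j\<in>peel J L b p. P \<in> L j} + m" .
  moreover have "k \<le> card {j\<in>J. P \<in> L j}"
    using P seg_subset_region[OF assms(4,3)] assms(2) by (auto simp: covers_def)
  ultimately show "k - m \<le> card {j\<in>peel J L b p. P \<in> L j}" by linarith
qed

text \<open>As long as an inner side has multiplicity at least 2, it is peeled off. Each step raises
  the sum of \<open>p\<close> by 1 and removes at least two lines; sum 1 means that the inner
  triangle is empty.\<close>

lemma maximal_peel_from:
  assumes "finite J" "\<forall>i<3. b i \<le> p i" "(\<Sum>i<3. p i) \<le> 1"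
    "int (card (peel J L b p)) + 2 * ((\<Sum>i<3. p i) - (\<Sum>i<3. b i)) \<le> int (card J)"
  shows "\<exists>p. (\<forall>i<3. b i \<le> p i) \<and> (\<Sum>i<3. p i) \<le> 1 \<and>
    int (card (peel J L b p)) + 2 * ((\<Sum>i<3. p i) - (\<Sum>i<3. b i)) \<le> int (card J) \<and>
    ((\<Sum>i<3. p i) = 1 \<or> (\<forall>i<3. line_mult (peel J L b p) L i (p i) \<le> 1))"
  using assms(2-)
proof (induction "nat (1 - (\<Sum>i<3. p i))" arbitrary: p)
  case 0
  then have "(\<Sum>i<3. p i) = 1" by linarith
  then show ?case using 0(2-) by blast
next
  case (Suc n)
  show ?case
  proof (cases "\<forall>i<3. line_mult (peel J L b p) L i (p i) \<le> 1")
    case True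
    then show ?thesis using Suc(3-) by blast
  next
    case False
    then obtain i where i: "i < 3" "line_mult (peel J L b p) L i (p i) \<ge> 2" by force
    define q where "q = p(i := p i + 1)"
    have sum: "(\<Sum>j<3. q j) = (\<Sum>j<3. p j) + 1"
      using i(1) by (auto simp: less_3 sum_less_3 q_def)
    have "card (peel J L b q) + line_mult (peel J L b p) L i (p i) = card (peel J L b p)"
      unfolding q_def by (rule card_peel_step) (use assms(1) i Suc(3) in auto)
    then have card: "int (card (peel J L b q)) + 2 \<le> int (card (peel J L b p))" using i(2) by linarith
    show ?thesis
    proof (rule Suc(1))
      show "n = nat (1 - (\<Sum>j<3. q j))" "(\<Sum>j<3. q j) \<le> 1" unfolding sum using Suc(2) by linarith+
      show "\<forall>i<3. b i \<le> q i" using Suc(3) by (auto simp: q_def intro: order_trans)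
      show "int (card (peel J L b q)) + 2 * ((\<Sum>i<3. q i) - (\<Sum>i<3. b i)) \<le> int (card J)"
        unfolding sum using card Suc(5) by (simp add: algebra_simps)
    qed
  qed
qed

lemma maximal_peel:
  assumes "finite J" "(\<Sum>i<3. b i) \<le> 1"
  obtains p where "\<forall>i<3. b i \<le> p i" "(\<Sum>i<3. p i) \<le> 1"
    "int (card (peel J L b p)) + 2 * ((\<Sum>i<3. p i) - (\<Sum>i<3. b i)) \<le> int (card J)"
    "(\<Sum>i<3. p i) = 1 \<or> (\<forall>i<3. line_mult (peel J L b p) L i (p i) \<le> 1)"
proof -
  have "int (card (peel J L b b)) + 2 * ((\<Sum>i<3. b i) - (\<Sum>i<3. b i)) \<le> int (card J)"
    by (simp add: peel_self)
  from maximal_peel_from[OF assms(1) _ assms(2) this] that show ?thesis by auto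
qed

lemma line_mult_peel:
  assumes "i < 3" "p i = b i"
  shows "line_mult (peel J L b p) L i (b i) = line_mult J L i (b i)"
proof -
  have "\<not> in_layers b p (lev i (b i))"
    using assms by (auto simp: in_layers_def lev_eq_iff)
  then have "{j\<in>peel J L b p. L j = lev i (b i)} = {j\<in>J. L j = lev i (b i)}"
    by (auto simp: peel_def)
  then show ?thesis by (simp add: line_mult_def)
qed

text \<open>The segment is parallel to an inner side, \<open>p i - b i\<close> levels further out,
  and gains one point per level.\<close>

lemma card_outer:
  assumes "i < 3" "\<forall>i<3. b i \<le> p i" "(\<Sum>i<3. p i) \<le> 1"
  shows "int (card (seg i (b i) p)) = 1 - (\<Sum>i<3. p i) + (p i - b i)"
  using assms card_seg[OF assms(1), of "b i" p] by auto

text \<open>A side line of the original triangle survives only if \<open>p i = b i\<close>. It then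
  contains its own \<open>1 - (\<Sum>i<3. p i)\<close> outer points and at most one from each of the
  other two sides.\<close>

lemma outer_Int_line:
  fixes b p :: "nat \<Rightarrow> int"
  assumes line: "lattice_line L" "\<not> in_layers b p L"
    and bp: "\<forall>i<3. b i \<le> p i" "(\<Sum>i<3. p i) \<le> 1"
    and disj: "\<And>i j. i < 3 \<Longrightarrow> j < 3 \<Longrightarrow> i \<noteq> j \<Longrightarrow> seg i (b i) p \<inter> seg j (b j) p = {}"
  shows "(\<Sum>i<3. int (card (seg i (b i) p \<inter> L)))
    \<le> 2 + (\<Sum>i<3. of_bool (L = lev i (b i)) * (1 - (\<Sum>i<3. p i)))"
proof (cases "\<exists>i<3. L = lev i (b i)")
  case False
  have "(\<Sum>i<3. card (seg i (b i) p \<inter> L)) \<le> 2"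
    by (rule sum_card_sides_le_2[OF line(1) _ seg_subset_lev seg_subset_region[OF _ bp(1)]])
      (use False disj in auto)
  then show ?thesis using False by (simp add: of_nat_sum[symmetric] del: of_nat_sum)
next
  case True
  then obtain i where i: "i < 3" "L = lev i (b i)" by blast
  have le: "card (seg j (b j) p \<inter> L) \<le> 1" if "j < 3" "j \<noteq> i" for j
    using that i by (intro card_Int_line_le_1[OF line(1), of j "b j"])
      (simp_all add: lev_eq_iff seg_subset_lev)
  have "seg i (b i) p \<inter> L = seg i (b i) p" using i(2) seg_subset_lev by blast
  moreover have "p i = b i"
    using line(2) i bp(1) unfolding in_layers_def by (metis order_le_less order_refl)
  ultimately have "int (card (seg i (b i) p \<inter> L)) = 1 - (\<Sum>i<3. p i)"
    using card_outer[OF i(1) bp] by simp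
  then have "(\<Sum>j<3. int (card (seg j (b j) p \<inter> L))) \<le> 2 + (1 - (\<Sum>i<3. p i))"
    using le[of 0] le[of 1] le[of 2] \<open>i < 3\<close>
    unfolding less_3 sum_less_3 by (elim disjE) simp_all
  moreover have "(\<Sum>j<3. of_bool (L = lev j (b j)) * (1 - (\<Sum>i<3. p i))) = 1 - (\<Sum>i<3. p i)"
    using i by (auto simp: less_3 sum_less_3 lev_eq_iff)
  ultimately show ?thesis by linarith
qed

lemma double_count_int:
  assumes "finite J" "finite A" "covers k J L A"
  shows "int k * int (card A) \<le> (\<Sum>j\<in>J. int (card (A \<inter> L j)))"
  using double_count[OF assms] by (metis of_nat_le_iff of_nat_mult of_nat_sum)

lemma finite_peel: "finite J \<Longrightarrow> finite (peel J L b p)"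
  using peel_subset finite_subset by metis

text \<open>The outer points of an unpeeled side are still covered three times, those of a peeled
  side at least once, as at most two copies of its line are gone. An unpeeled side occurs at most
  once if \<open>m > 0\<close>, and this one copy lowers its demand from \<open>3 * m\<close> to
  \<open>2 * m\<close>.\<close>

lemma outer_count:
  fixes b p :: "nat \<Rightarrow> int"
  assumes J: "finite J" "\<forall>j\<in>J. lattice_line (L j)" "covers 3 J L (region b)"
    and bp: "\<forall>i<3. b i \<le> p i" "(\<Sum>i<3. p i) \<le> 1"
    and disj: "\<And>i j. i < 3 \<Longrightarrow> j < 3 \<Longrightarrow> i \<noteq> j \<Longrightarrow> seg i (b i) p \<inter> seg j (b j) p = {}"
    and mult: "\<forall>i<3. line_mult J L i (b i) \<le> 2"
    and mult': "(\<Sum>i<3. p i) = 1 \<or> (\<forall>i<3. line_mult (peel J L b p) L i (p i) \<le> 1)"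
  defines "m \<equiv> 1 - (\<Sum>i<3. p i)"
  shows "(\<Sum>i<3. if p i = b i then 2 * m else m + (p i - b i)) \<le> 2 * int (card (peel J L b p))"
proof -
  let ?J = "peel J L b p"
  have fin: "finite ?J" using finite_peel J(1) by blast
  have need: "(if p i = b i then 3 * m else m + (p i - b i)) \<le> (\<Sum>j\<in>?J. int (card (seg i (b i) p \<inter> L j)))"
    if i: "i < 3" for i
  proof (cases "p i = b i")
    case True
    have "seg i (b i) p \<subseteq> region p" using seg_subset_region[OF i, of p p] True by simp
    then have "covers 3 ?J L (seg i (b i) p)"
      using covers_peel_region[OF J(3) bp(1)] covers_subset by metis
    from double_count_int[OF fin finite_seg[OF i] this] show ?thesis
      using True card_outer[OF i bp] by (simp add: m_def)
  next
    case False
    have "covers (3 - 2) ?J L (seg i (b i) p)"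
      by (rule covers_peel_side[OF J(1,3) bp(1) i]) (use mult i in auto)
    from double_count_int[OF fin finite_seg[OF i] this] show ?thesis
      using False card_outer[OF i bp] by (simp add: m_def)
  qed
  have own: "of_bool (p i = b i) * m \<ge> int (line_mult ?J L i (b i)) * m" if i: "i < 3" for i
  proof (cases "p i = b i")
    case True
    \<comment> \<open>If peeling ended with an empty inner triangle, multiplicities may exceed 1,
      but then the term vanishes.\<close>
    have "m = 0 \<or> int (line_mult ?J L i (p i)) \<le> 1" using mult' i by (auto simp: m_def)
    then have "int (line_mult ?J L i (p i)) * m \<le> 1 * m"
      using bp(2) mult_right_mono[of "int (line_mult ?J L i (p i))" 1 m] by (auto simp: m_def)
    then show ?thesis using True by simp
  next
    case False
    then have "b i < p i" using bp i by (metis order_le_less)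
    then have "{j\<in>?J. L j = lev i (b i)} = {}" using i by (auto simp: peel_def in_layers_def)
    then have "line_mult ?J L i (b i) = 0" unfolding line_mult_def by (simp only: card.empty)
    then show ?thesis using False by simp
  qed
  have "(\<Sum>i<3. if p i = b i then 3 * m else m + (p i - b i))
    \<le> (\<Sum>i<3. \<Sum>j\<in>?J. int (card (seg i (b i) p \<inter> L j)))"
    using need by (intro sum_mono) auto
  also have "\<dots> = (\<Sum>j\<in>?J. \<Sum>i<3. int (card (seg i (b i) p \<inter> L j)))"
    by (rule sum.swap)
  also have "\<dots> \<le> (\<Sum>j\<in>?J. 2 + (\<Sum>i<3. of_bool (L j = lev i (b i)) * m))"
    unfolding m_def
    by (intro sum_mono outer_Int_line[OF _ _ bp disj]) (use J(2) in \<open>auto simp: peel_def\<close>)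
  also have "\<dots> = 2 * int (card ?J) + (\<Sum>i<3. int (line_mult ?J L i (b i)) * m)"
    unfolding sum.distrib sum.swap[of _ "{..<3}" ?J] sum_of_bool_line[OF fin] by simp
  also have "\<dots> \<le> 2 * int (card ?J) + (\<Sum>i<3. of_bool (p i = b i) * m)"
    using own by (intro add_left_mono sum_mono) auto
  finally show ?thesis by (auto simp: sum_less_3 split: if_splits)
qed

subsection \<open>The inner triangle\<close>

text \<open>The inner sides are taken with both end points, which gives inner corners weight 2. More
  than 4 would need outer weight 2 and a point on every inner side; then \<open>L\<close> passes
  through an inner corner and misses the outer points of both sides parallel to the inner sides at
  that corner.\<close>

lemma inner_outer_Int_line_generic:
  fixes b p :: "nat \<Rightarrow> int"
  assumes line: "lattice_line L" "\<And>i. i < 3 \<Longrightarrow> L \<noteq> lev i (b i)" "\<And>i. i < 3 \<Longrightarrow> L \<noteq> lev i (p i)"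
    and bp: "\<forall>i<3. b i < p i" "(\<Sum>i<3. p i) \<le> -1"
    and disj: "\<And>i j. i < 3 \<Longrightarrow> j < 3 \<Longrightarrow> i \<noteq> j \<Longrightarrow> seg i (b i) p \<inter> seg j (b j) p = {}"
  shows "(\<Sum>i<3. card (seg i (b i) p \<inter> L)) + (\<Sum>i<3. card (seg i (p i) p \<inter> L)) \<le> 4"
proof (rule ccontr)
  assume neg: "\<not> ?thesis"
  have bp': "\<forall>i<3. b i \<le> p i" using bp(1) by (simp add: order_less_imp_le)
  have outer: "(\<Sum>i<3. card (seg i (b i) p \<inter> L)) \<le> 2"
    by (rule sum_card_sides_le_2[OF line(1) _ seg_subset_lev seg_subset_region[OF _ bp']])
      (use line(2) disj in auto)
  have outer1: "card (seg i (b i) p \<inter> L) \<le> 1" if "i < 3" for i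
    by (rule card_Int_line_le_1[OF line(1) line(2)[OF that] seg_subset_lev])
  have inner1: "card (seg i (p i) p \<inter> L) \<le> 1" if "i < 3" for i
    by (rule card_Int_line_le_1[OF line(1) line(3)[OF that] seg_subset_lev])
  have "card (seg 0 (p 0) p \<inter> L) \<noteq> 0" "card (seg 1 (p 1) p \<inter> L) \<noteq> 0" "card (seg 2 (p 2) p \<inter> L) \<noteq> 0"
    using neg outer inner1[of 0] inner1[of 1] inner1[of 2] unfolding sum_less_3 by linarith+
  then obtain P Q S where PQS: "P \<in> seg 0 (p 0) p \<inter> L" "Q \<in> seg 1 (p 1) p \<inter> L" "S \<in> seg 2 (p 2) p \<inter> L"
    by (metis card.empty ex_in_conv)
  have seg: "co i U = p i" "U \<in> L" "U \<in> region p" if "U \<in> seg i (p i) p \<inter> L" "i < 3" for i U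
    using that seg_subset_region[of i p p] by (auto simp: seg_def)
  have "P = Q \<or> Q = S \<or> P = S"
    using triangle_sides_not_collinear[OF line(1) line(3)] PQS seg by (metis less_3)
  then obtain i j k C D where ijk: "{i, j, k} = {0, 1, 2}" "i < 3" "j < 3" "k < 3" "i \<noteq> j" "i \<noteq> k" "j \<noteq> k"
    and C: "C \<in> seg i (p i) p \<inter> L" "C \<in> seg j (p j) p \<inter> L" and D: "D \<in> seg k (p k) p \<inter> L"
  proof (elim disjE)
    assume "P = Q"
    then show ?thesis using that[of 0 1 2 P S] PQS by auto
  next
    assume "Q = S"
    then show ?thesis using that[of 1 2 0 Q P] PQS by auto
  next
    assume "P = S"
    then show ?thesis using that[of 0 2 1 P Q] PQS by auto
  qed
  have sum_ijk: "(\<Sum>i<3. \<phi> i) = \<phi> i + \<phi> j + \<phi> k" for \<phi> :: "nat \<Rightarrow> int"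
  proof -
    have eq: "{..<3} = {i, j, k}" using ijk(1) by (auto simp: less_3)
    show ?thesis unfolding eq using ijk(5-7) by simp
  qed
  \<comment> \<open>A point common to all three inner sides would force the sum of \<open>p\<close>
    to be 0.\<close>
  have "C \<noteq> D"
  proof
    assume "C = D"
    then have "(\<Sum>i<3. p i) = (\<Sum>i<3. co i C)" using C D by (simp add: sum_ijk seg_def)
    then show False using bp(2) by (simp add: sum_co)
  qed
  have D_gt: "p l < co l D" if l: "l < 3" "C \<in> seg l (p l) p \<inter> L" for l
  proof -
    have "co l D \<noteq> p l"
      using lattice_line_eq_lev[OF line(1) _ _ \<open>C \<noteq> D\<close>, of l "p l"] l D line(3)[OF l(1)] by (auto simp: seg_def)
    moreover have "p l \<le> co l D" using seg(3)[OF D ijk(4)] l(1) by (simp add: region_def)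
    ultimately show ?thesis by simp
  qed
  text \<open>Since \<open>D\<close> lies strictly inside the angle at the corner \<open>C\<close>, the line leaves the
    inner triangle through \<open>C\<close> into the opposite angle, where there are no outer points.\<close>
  have empty: "seg l (b l) p \<inter> L = {}" if l: "l < 3" "l' < 3" "l \<noteq> l'"
    "C \<in> seg l (p l) p \<inter> L" "C \<in> seg l' (p l') p \<inter> L" for l l'
  proof (rule ccontr)
    assume "seg l (b l) p \<inter> L \<noteq> {}"
    then obtain E where "E \<in> seg l (b l) p" and EL: "E \<in> L" by blast
    then have E: "co l E = b l" "p l' \<le> co l' E" "E \<in> L" using l by (simp_all add: seg_def)
    have "orient C D E = 0" using lattice_line_orient[OF line(1)] C D E by blast
    \<comment> \<open>In any two of the three coordinates the orientation is the same determinant up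
      to sign.\<close>
    then have "(co l E - co l C) * (co l' D - co l' C) = (co l' E - co l' C) * (co l D - co l C)"
      using l(1-3) by (auto simp: less_3 orient_def algebra_simps)
    moreover have Cl: "co l C = p l" "co l' C = p l'" using l by (auto simp: seg_def)
    have "0 \<le> (co l' E - co l' C) * (co l D - co l C)"
      using E D_gt[OF l(1,4)] Cl by simp
    moreover have "(co l E - co l C) * (co l' D - co l' C) < 0"
      using E D_gt[OF l(2,5)] Cl bp(1) l(1) by (intro mult_neg_pos) auto
    ultimately show False by simp
  qed
  have "seg i (b i) p \<inter> L = {}" "seg j (b j) p \<inter> L = {}"
    using empty[of i j] empty[of j i] ijk C by auto
  then have "(\<Sum>i<3. int (card (seg i (b i) p \<inter> L))) \<le> 1"
    using outer1[OF ijk(4)] by (simp add: sum_ijk)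
  then have "(\<Sum>i<3. card (seg i (b i) p \<inter> L)) \<le> 1" by (simp add: of_nat_sum[symmetric] del: of_nat_sum)
  moreover have "(\<Sum>i<3. card (seg i (p i) p \<inter> L)) \<le> 3"
    using inner1[of 0] inner1[of 1] inner1[of 2] by (simp add: sum_less_3)
  ultimately show False using neg by linarith
qed

text \<open>An inner side line contains all points of its own segment, none of the parallel outer
  segment, and at most one of each of the four remaining segments.\<close>

lemma inner_outer_Int_line:
  fixes b p :: "nat \<Rightarrow> int"
  assumes line: "lattice_line L" "\<not> in_layers b p L"
    and bp: "\<forall>i<3. b i < p i" "(\<Sum>i<3. p i) \<le> -1"
    and disj: "\<And>i j. i < 3 \<Longrightarrow> j < 3 \<Longrightarrow> i \<noteq> j \<Longrightarrow> seg i (b i) p \<inter> seg j (b j) p = {}"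
  shows "(\<Sum>i<3. int (card (seg i (b i) p \<inter> L))) + (\<Sum>i<3. int (card (seg i (p i) p \<inter> L)))
    \<le> 4 + (\<Sum>i<3. of_bool (L = lev i (p i)) * (1 - (\<Sum>i<3. p i)))"
proof (cases "\<exists>i<3. L = lev i (p i)")
  case False
  have "L \<noteq> lev i (b i)" if "i < 3" for i using line(2) bp(1) that by (auto simp: in_layers_def)
  then have "(\<Sum>i<3. card (seg i (b i) p \<inter> L)) + (\<Sum>i<3. card (seg i (p i) p \<inter> L)) \<le> 4"
    using False by (intro inner_outer_Int_line_generic[OF line(1) _ _ bp disj]) auto
  then have "int ((\<Sum>i<3. card (seg i (b i) p \<inter> L)) + (\<Sum>i<3. card (seg i (p i) p \<inter> L))) \<le> 4" by linarith
  then show ?thesis using False by simp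
next
  case True
  then obtain i where i: "i < 3" "L = lev i (p i)" by blast
  have le: "card (seg j t p \<inter> L) \<le> 1" if "j < 3" "j \<noteq> i" for j t
    using that i by (intro card_Int_line_le_1[OF line(1), of j t])
      (simp_all add: lev_eq_iff seg_subset_lev)
  have "seg i (p i) p \<inter> L = seg i (p i) p" using i(2) seg_subset_lev by blast
  then have own: "int (card (seg i (p i) p \<inter> L)) = 1 - (\<Sum>i<3. p i)"
    using card_seg[OF i(1), of "p i" p] bp(2) by simp
  have "b i \<noteq> p i" using bp(1) i(1) by auto
  then have "seg i (b i) p \<inter> L = {}" using i(2) by (auto simp: seg_def lev_def)
  then have "(\<Sum>j<3. int (card (seg j (b j) p \<inter> L))) + (\<Sum>j<3. int (card (seg j (p j) p \<inter> L)))
    \<le> 4 + (1 - (\<Sum>i<3. p i))"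
    using le[of 0 "b 0"] le[of 1 "b 1"] le[of 2 "b 2"] le[of 0 "p 0"] le[of 1 "p 1"] le[of 2 "p 2"]
      own \<open>i < 3\<close>
    unfolding less_3 sum_less_3 by (elim disjE) simp_all
  moreover have "(\<Sum>j<3. of_bool (L = lev j (p j)) * (1 - (\<Sum>i<3. p i))) = 1 - (\<Sum>i<3. p i)"
    using i by (auto simp: less_3 sum_less_3 lev_eq_iff)
  ultimately show ?thesis by linarith
qed

text \<open>Inner sides demand \<open>9 * m\<close> and outer sides \<open>3 * m\<close> plus the
  number of peeled levels. Each line supplies 4, and the three inner side lines, each occurring at
  most once, together supply at most \<open>3 * m\<close> more.\<close>

lemma inner_outer_count:
  fixes b p :: "nat \<Rightarrow> int"
  assumes J: "finite J" "\<forall>j\<in>J. lattice_line (L j)" "covers 3 J L (region b)"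
    and bp: "\<forall>i<3. b i < p i" "(\<Sum>i<3. p i) \<le> -1"
    and disj: "\<And>i j. i < 3 \<Longrightarrow> j < 3 \<Longrightarrow> i \<noteq> j \<Longrightarrow> seg i (b i) p \<inter> seg j (b j) p = {}"
    and mult: "\<forall>i<3. line_mult J L i (b i) \<le> 2"
    and mult': "\<forall>i<3. line_mult (peel J L b p) L i (p i) \<le> 1"
  defines "m \<equiv> 1 - (\<Sum>i<3. p i)"
  shows "9 * m + ((\<Sum>i<3. p i) - (\<Sum>i<3. b i)) \<le> 4 * int (card (peel J L b p))"
proof -
  let ?J = "peel J L b p"
  have fin: "finite ?J" using finite_peel J(1) by blast
  have bp': "\<forall>i<3. b i \<le> p i" using bp(1) by (simp add: order_less_imp_le)
  have need: "m + (p i - b i) + 3 * m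
    \<le> (\<Sum>j\<in>?J. int (card (seg i (b i) p \<inter> L j))) + (\<Sum>j\<in>?J. int (card (seg i (p i) p \<inter> L j)))"
    if i: "i < 3" for i
  proof -
    have "seg i (p i) p \<subseteq> region p" using seg_subset_region[OF i, of p p] by simp
    then have "covers 3 ?J L (seg i (p i) p)"
      using covers_peel_region[OF J(3) bp'] covers_subset by metis
    from double_count_int[OF fin finite_seg[OF i] this]
    have "3 * m \<le> (\<Sum>j\<in>?J. int (card (seg i (p i) p \<inter> L j)))"
      using card_seg[OF i, of "p i" p] bp(2) by (simp add: m_def)
    moreover have "covers (3 - 2) ?J L (seg i (b i) p)"
      by (rule covers_peel_side[OF J(1,3) bp' i]) (use mult i in auto)
    from double_count_int[OF fin finite_seg[OF i] this]
    have "m + (p i - b i) \<le> (\<Sum>j\<in>?J. int (card (seg i (b i) p \<inter> L j)))"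
      using card_outer[OF i bp'] bp(2) by (simp add: m_def)
    ultimately show ?thesis by linarith
  qed
  have "(\<Sum>i<3. m + (p i - b i) + 3 * m)
    \<le> (\<Sum>i<3. (\<Sum>j\<in>?J. int (card (seg i (b i) p \<inter> L j))) + (\<Sum>j\<in>?J. int (card (seg i (p i) p \<inter> L j))))"
    using need by (intro sum_mono) auto
  also have "\<dots> = (\<Sum>j\<in>?J. (\<Sum>i<3. int (card (seg i (b i) p \<inter> L j))) + (\<Sum>i<3. int (card (seg i (p i) p \<inter> L j))))"
    unfolding sum.distrib sum.swap[of _ "{..<3}" ?J] ..
  also have "\<dots> \<le> (\<Sum>j\<in>?J. 4 + (\<Sum>i<3. of_bool (L j = lev i (p i)) * m))"
    unfolding m_def
    by (intro sum_mono inner_outer_Int_line[OF _ _ bp disj]) (use J(2) in \<open>auto simp: peel_def\<close>)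
  also have "\<dots> = 4 * int (card ?J) + (\<Sum>i<3. int (line_mult ?J L i (p i)) * m)"
    unfolding sum.distrib sum.swap[of _ "{..<3}" ?J] sum_of_bool_line[OF fin] by simp
  also have "\<dots> \<le> 4 * int (card ?J) + (\<Sum>i<(3::nat). 1 * m)"
  proof (intro add_left_mono sum_mono mult_right_mono)
    show "int (line_mult ?J L i (p i)) \<le> 1" if "i \<in> {..<3}" for i using mult' that by force
  qed (use bp(2) in \<open>simp add: m_def\<close>)
  finally show ?thesis by (simp add: sum_less_3)
qed

text \<open>A common point would satisfy all bounds of \<open>p\<close>, so the inner triangle would
  be nonempty, and it would be a corner between two unpeeled sides.\<close>

lemma outer_sides_disjoint:
  assumes ij: "i < 3" "j < 3" "i \<noteq> j" and bp: "\<forall>i<3. b i \<le> p i"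
    and ne: "(\<Sum>i<3. p i) = 1 \<or> b i < p i \<or> b j < p j"
  shows "seg i (b i) p \<inter> seg j (b j) p = {}"
proof (rule ccontr)
  assume "\<not> ?thesis"
  then obtain P where P: "P \<in> seg i (b i) p" "P \<in> seg j (b j) p" by blast
  have "p l \<le> co l P" if "l < 3" for l
    using P that ij(3) by (cases "l = i") (auto simp: seg_def)
  then have "(\<Sum>l<3. p l) \<le> (\<Sum>l<3. co l P)" by (intro sum_mono) auto
  moreover have "p i \<le> b i" "p j \<le> b j" using P ij by (auto simp: seg_def)
  ultimately show False using ne by (simp add: sum_co)
qed

section \<open>The lower bound for covers of multiplicity 3\<close>

lemma lower_bound_3:
  assumes "finite J" "\<forall>j\<in>J. lattice_line (L j)" "covers 3 J L (region b)" "(\<Sum>i<3. b i) \<le> 1"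
  shows "9 * (1 - (\<Sum>i<3. b i)) \<le> 4 * int (card J)"
proof (rule lower_bound_by_removing_sides[OF _ assms])
  fix J :: "'a set" and b
  assume J: "finite J" "\<forall>j\<in>J. lattice_line (L j)" "covers 3 J L (region b)" and b: "(\<Sum>i<3. b i) \<le> 0"
    and "\<forall>i<3. 4 * int (line_mult J L i (b i)) < 9"
  then have mult: "\<forall>i<3. line_mult J L i (b i) \<le> 2" by force
  define n where "n = 1 - (\<Sum>i<3. b i)"
  define s where "s = (\<Sum>i<3. int (line_mult J L i (b i)))"
  have "9 * n \<le> 4 * int (card J)"
  \<comment> \<open>For \<open>s \<le> 4\<close> the boundary count gives
    \<open>4 * card J \<ge> 10 * n - 2\<close>, which suffices for \<open>n \<ge> 2\<close>. For
    \<open>s \<ge> 5\<close> at least two sides have multiplicity 2.\<close>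
  proof (cases "n \<le> 1 \<or> s \<le> 4")
    case True
    show ?thesis
    proof (cases "n \<le> 1")
      case True
      then show ?thesis using covers_nonempty[OF J(1,3) b] by linarith
    next
      case False
      have "3 * int 3 * - (\<Sum>i<3. b i) \<le> 2 * int (card J) + s * (- (\<Sum>i<3. b i) - 1)"
        unfolding s_def by (rule boundary_count[OF J]) (use False in \<open>simp add: n_def\<close>)
      moreover have "- (\<Sum>i<3. b i) = n - 1" by (simp add: n_def)
      ultimately have "9 * (n - 1) \<le> 2 * int (card J) + s * (n - 2)" by simp
      moreover have "s * (n - 2) \<le> 4 * (n - 2)"
        using True False by (intro mult_right_mono) auto
      ultimately have "9 * (n - 1) \<le> 2 * int (card J) + 4 * (n - 2)" by (rule order_trans[OF _ add_left_mono])
      then show ?thesis using False by (simp add: algebra_simps)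
    qed
  next
    case False
    then have n: "2 \<le> n" and s: "5 \<le> s" by auto
    have b1: "(\<Sum>i<3. b i) \<le> 1" using b by simp
    obtain p where p: "\<forall>i<3. b i \<le> p i" "(\<Sum>i<3. p i) \<le> 1"
      "int (card (peel J L b p)) + 2 * ((\<Sum>i<3. p i) - (\<Sum>i<3. b i)) \<le> int (card J)"
      and stop: "(\<Sum>i<3. p i) = 1 \<or> (\<forall>i<3. line_mult (peel J L b p) L i (p i) \<le> 1)"
      using maximal_peel[OF J(1) b1, of L] .
    let ?J = "peel J L b p"
    define m where "m = 1 - (\<Sum>i<3. p i)"
    \<comment> \<open>The \<open>n - m\<close> peeled layers account for two lines each, so
      \<open>n + 8 * m \<le> 4 * int (card ?J)\<close> remains to be shown.\<close>
    have card: "4 * int (card ?J) + 8 * n - 8 * m \<le> 4 * int (card J)"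
      using p(3) by (simp add: n_def m_def algebra_simps)
    \<comment> \<open>If \<open>m > 0\<close>, an unpeeled side has multiplicity at most 1, and
      \<open>s \<ge> 5\<close> allows only one such side.\<close>
    have unique: "m = 0 \<or> b i < p i \<or> b j < p j" if ij: "i < 3" "j < 3" "i \<noteq> j" for i j
    proof (rule ccontr)
      assume neg: "\<not> ?thesis"
      then have eq: "p i = b i" "p j = b j" using p(1) ij by force+
      then have "line_mult J L i (b i) \<le> 1" "line_mult J L j (b j) \<le> 1"
        using stop neg ij line_mult_peel[of i p b J L] line_mult_peel[of j p b J L] by (auto simp: m_def)
      moreover obtain k where k: "{..<3} = {i, j, k}" "k \<noteq> i" "k \<noteq> j" "k < 3"
      proof -
        have "\<exists>k. {..<3} = {i, j, k} \<and> k \<noteq> i \<and> k \<noteq> j \<and> k < 3"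
          using ij by (intro exI[of _ "3 - i - j"]) (auto simp: less_3)
        then show ?thesis using that by blast
      qed
      moreover have "s = int (line_mult J L i (b i)) + int (line_mult J L j (b j)) + int (line_mult J L k (b k))"
        unfolding s_def k(1) using k ij(3) by simp
      moreover have "line_mult J L k (b k) \<le> 2" using mult k(4) by blast
      ultimately show False using s by linarith
    qed
    have disj: "seg i (b i) p \<inter> seg j (b j) p = {}" if "i < 3" "j < 3" "i \<noteq> j" for i j
      using outer_sides_disjoint[OF that p(1)] unique[OF that] by (auto simp: m_def)
    have outer: "(\<Sum>i<3. if p i = b i then 2 * m else m + (p i - b i)) \<le> 2 * int (card ?J)"
      unfolding m_def by (rule outer_count[OF J p(1,2) disj mult stop])
    have D: "p 0 + p 1 + p 2 - (b 0 + b 1 + b 2) = n - m" by (simp add: n_def m_def sum_less_3)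
    consider "m = 0" | "0 < m" "\<exists>i<3. p i = b i" | "m = 1" "\<forall>i<3. b i < p i" | "2 \<le> m" "\<forall>i<3. b i < p i"
      using p(1,2) by (force simp: m_def)
    then show ?thesis
    proof cases
      case 1
      have "(\<Sum>i<3. if p i = b i then 2 * m else m + (p i - b i)) = n - m"
        using D 1 by (simp add: sum_less_3)
      then show ?thesis using outer card 1 n by linarith
    next
      case 2
      then obtain i where i: "i < 3" "p i = b i" by blast
      have others: "b j < p j" if "j < 3" "j \<noteq> i" for j using unique[OF that(1) i(1) that(2)] 2(1) i(2) by simp
      have "(\<Sum>i<3. if p i = b i then 2 * m else m + (p i - b i)) = n + 3 * m \<and> m + 2 \<le> n"
      proof -
        consider "i = 0" | "i = 1" | "i = 2" using i(1) unfolding less_3 by blast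
        then show ?thesis
        proof cases
          case 1
          then show ?thesis using i(2) others[of 1] others[of 2] D by (simp add: sum_less_3)
        next
          case 2
          then show ?thesis using i(2) others[of 0] others[of 2] D by (simp add: sum_less_3)
        next
          case 3
          then show ?thesis using i(2) others[of 0] others[of 1] D by (simp add: sum_less_3)
        qed
      qed
      then have c1: "n + 3 * m \<le> 2 * int (card ?J)" and nm: "m + 2 \<le> n" using outer by linarith+
      show ?thesis
      proof (cases "m = 1")
        case True
        then show ?thesis using c1 card n by linarith
      next
        case False
        have J': "\<forall>j\<in>?J. lattice_line (L j)" using J(2) by (simp add: peel_def)
        have "3 * int 3 * - (\<Sum>i<3. p i)
          \<le> 2 * int (card ?J) + (\<Sum>i<3. int (line_mult ?J L i (p i))) * (- (\<Sum>i<3. p i) - 1)"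
          by (rule boundary_count[OF finite_peel[OF J(1)] J' covers_peel_region[OF J(3) p(1)]])
            (use 2(1) False in \<open>simp add: m_def\<close>)
        moreover have "- (\<Sum>i<3. p i) = m - 1" by (simp add: m_def)
        ultimately have "9 * (m - 1) \<le> 2 * int (card ?J) + (\<Sum>i<3. int (line_mult ?J L i (p i))) * (m - 2)"
          by simp
        moreover have "(\<Sum>i<3. int (line_mult ?J L i (p i))) \<le> (\<Sum>i<(3::nat). 1)"
          using stop 2(1) by (intro sum_mono) (auto simp: m_def)
        then have "(\<Sum>i<3. int (line_mult ?J L i (p i))) * (m - 2) \<le> 3 * (m - 2)"
          using 2(1) False by (intro mult_right_mono) auto
        ultimately have "6 * m - 3 \<le> 2 * int (card ?J)" by (simp add: algebra_simps)
        \<comment> \<open>For \<open>m \<ge> 3\<close> the sum of the outer and the inner count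
          suffices. For \<open>m = 2\<close> twice the outer count does, because two peeled sides
          give \<open>n \<ge> m + 2 = 2 * m\<close>.\<close>
        then show ?thesis using c1 card nm by linarith
      qed
    next
      case 3
      have "p i \<noteq> b i" "b i + 1 \<le> p i" if "i < 3" for i using 3(2) that by force+
      from this[of 0] this[of 1] this[of 2]
      have "(\<Sum>i<3. if p i = b i then 2 * m else m + (p i - b i)) = n + 2 * m" "3 \<le> n - m"
        using D by (auto simp: sum_less_3)
      \<comment> \<open>Three peeled layers give \<open>n \<ge> 4\<close>, hence
        \<open>2 * n + 4 \<ge> n + 8\<close>.\<close>
      then show ?thesis using outer card 3(1) by linarith
    next
      case 4
      have "9 * m + (n - m) \<le> 4 * int (card ?J)"
        using inner_outer_count[OF J 4(2) _ disj mult] stop 4(1) by (simp add: n_def m_def)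
      then show ?thesis using card by linarith
    qed
  qed
  then show "9 * (1 - (\<Sum>i<3. b i)) \<le> 4 * int (card J)" by (simp add: n_def)
qed simp

subsection \<open>Hyperplane covers of the grid\<close>

lemma sum_less_2: "(\<Sum>i<2. \<phi> i) = \<phi> 0 + \<phi> (1::nat)"
  by (simp add: numeral_2_eq_2)

definition hyperplane_trace :: "(nat \<Rightarrow> real) \<times> real \<Rightarrow> (int \<times> int) set" where
  "hyperplane_trace H = {P. fst H 0 * of_int (fst P) + fst H 1 * of_int (snd P) = snd H}"

text \<open>The normal vector is orthogonal to \<open>Q - P\<close>, hence a nonzero multiple of
  that vector turned by a right angle; so the equation of the line is a multiple of
  \<open>orient P Q S = 0\<close>.\<close>

lemma lattice_line_hyperplane_trace:
  assumes "is_hyperplane 2 H"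
  shows "lattice_line (hyperplane_trace H)"
  unfolding lattice_line_def
proof (intro ballI impI)
  fix P Q assume PQ: "P \<in> hyperplane_trace H" "Q \<in> hyperplane_trace H" "P \<noteq> Q"
  define a c where "a = fst H 0" "c = fst H 1"
  have ac: "a \<noteq> 0 \<or> c \<noteq> 0"
    using assms by (auto simp: is_hyperplane_def a_c_def less_2_cases_iff)
  define u v :: real where "u = of_int (fst Q - fst P)" "v = of_int (snd Q - snd P)"
  have uv: "u \<noteq> 0 \<or> v \<noteq> 0" using PQ(3) by (auto simp: u_v_def prod_eq_iff)
  have dir: "a * u + c * v = 0"
    using PQ(1,2) by (simp add: hyperplane_trace_def a_c_def u_v_def algebra_simps)
  obtain t where t: "t \<noteq> 0" "a = - t * v" "c = t * u"
  proof (cases "u = 0")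
    case True
    then show ?thesis using that[of "- a / v"] uv dir ac by auto
  next
    case False
    then have "a = - (c / u) * v" using dir by (simp add: field_simps)
    then show ?thesis using that[of "c / u"] False ac by auto
  qed
  have "S \<in> hyperplane_trace H \<longleftrightarrow> orient P Q S = 0" for S
  proof -
    have "S \<in> hyperplane_trace H \<longleftrightarrow> a * of_int (fst S - fst P) + c * of_int (snd S - snd P) = 0"
      using PQ(1) by (simp add: hyperplane_trace_def a_c_def algebra_simps)
    also have "a * of_int (fst S - fst P) + c * of_int (snd S - snd P) = t * of_int (orient P Q S)"
      by (simp add: t(2,3) u_v_def orient_def algebra_simps)
    finally show ?thesis using t(1) by simp
  qed
  then show "hyperplane_trace H = {S. orient P Q S = 0}" by blast
qed

text \<open>The third bound encodes \<open>x + y \<le> n - 1\<close>, as \<open>co 2\<close> is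
  \<open>- x - y\<close>.\<close>

definition grid_bounds :: "nat \<Rightarrow> nat \<Rightarrow> int" where
  "grid_bounds n i = (if i = 2 then 1 - int n else 0)"

lemma sum_grid_bounds: "(\<Sum>i<3. grid_bounds n i) = 1 - int n"
  by (simp add: sum_less_3 grid_bounds_def)

text \<open>Listing the multiset and indexing by list positions preserves multiplicities.\<close>

lemma is_k_cover_covers:
  assumes "is_k_cover n 2 k M"
  obtains J :: "nat set" and L where "finite J" "\<forall>j\<in>J. lattice_line (L j)"
    "covers k J L (region (grid_bounds n))" "card J = size M"
proof -
  obtain xs where xs: "M = mset xs" by (metis ex_mset)
  define L where "L j = hyperplane_trace (xs ! j)" for j
  show ?thesis
  proof (rule that[of "{..<length xs}" L])
    show "\<forall>j\<in>{..<length xs}. lattice_line (L j)"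
      using assms by (auto simp: L_def is_k_cover_def xs intro!: lattice_line_hyperplane_trace)
    show "covers k {..<length xs} L (region (grid_bounds n))"
      unfolding covers_def
    proof
      fix P assume P: "P \<in> region (grid_bounds n)"
      define v :: "nat \<Rightarrow> real" where "v i = (if i = 0 then of_int (fst P) else if i = 1 then of_int (snd P) else 0)" for i
      have "v \<in> tri_grid n 2"
        unfolding tri_grid_def
      proof (intro CollectI exI conjI)
        let ?y = "\<lambda>i::nat. if i = 0 then nat (fst P) else if i = 1 then nat (snd P) else 0 :: nat"
        show "\<forall>i. v i = real (?y i)"
          using P by (auto simp: v_def region_def all_less_3 grid_bounds_def)
        show "\<forall>i\<ge>2. ?y i = 0" by auto
        show "(\<Sum>i<2. ?y i) + 1 \<le> n"
          using P by (auto simp: sum_less_2 region_def all_less_3 grid_bounds_def)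
      qed
      then have "k \<le> size (filter_mset (on_hyperplane 2 v) M)"
        using assms by (auto simp: is_k_cover_def)
      also have "\<dots> = length (filter (on_hyperplane 2 v) xs)" unfolding xs by (metis mset_filter size_mset)
      also have "\<dots> = card {j. j < length xs \<and> on_hyperplane 2 v (xs ! j)}"
        by (rule length_filter_conv_card)
      also have "{j. j < length xs \<and> on_hyperplane 2 v (xs ! j)} = {j\<in>{..<length xs}. P \<in> L j}"
        by (auto simp: L_def hyperplane_trace_def on_hyperplane_def sum_less_2 v_def)
      finally show "k \<le> card {j\<in>{..<length xs}. P \<in> L j}" .
    qed
  qed (simp_all add: xs)
qed

lemma cover_lower_bounds:
  fixes n :: nat
  shows "is_k_cover n 2 1 M \<Longrightarrow> n \<le> size M"
    and "is_k_cover n 2 2 M \<Longrightarrow> 3 * n \<le> 2 * size M"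
    and "is_k_cover n 2 3 M \<Longrightarrow> 9 * n \<le> 4 * size M"
    and "is_k_cover n 2 4 M \<Longrightarrow> 3 * n \<le> size M"
proof -
  have le: "(\<Sum>i<3. grid_bounds n i) \<le> 1" by (simp add: sum_grid_bounds)
  show "n \<le> size M" if "is_k_cover n 2 1 M"
    using is_k_cover_covers[OF that] lower_bound_1[OF _ _ _ le] unfolding sum_grid_bounds by (smt (verit) of_nat_le_iff)
  show "3 * n \<le> 2 * size M" if M: "is_k_cover n 2 2 M"
  proof -
    obtain J :: "nat set" and L where J: "finite J" "\<forall>j\<in>J. lattice_line (L j)"
      "covers 2 J L (region (grid_bounds n))" "card J = size M" using is_k_cover_covers[OF M] .
    have "3 * int 1 * (1 - (\<Sum>i<3. grid_bounds n i)) \<le> 2 * int (card J)"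
      by (rule lower_bound_even[OF _ J(1,2) _ le]) (use J(3) in simp_all)
    then show ?thesis unfolding sum_grid_bounds J(4) by simp
  qed
  show "9 * n \<le> 4 * size M" if M: "is_k_cover n 2 3 M"
  proof -
    obtain J :: "nat set" and L where J: "finite J" "\<forall>j\<in>J. lattice_line (L j)"
      "covers 3 J L (region (grid_bounds n))" "card J = size M" using is_k_cover_covers[OF M] .
    show ?thesis using lower_bound_3[OF J(1-3) le] unfolding sum_grid_bounds J(4) by simp
  qed
  show "3 * n \<le> size M" if M: "is_k_cover n 2 4 M"
  proof -
    obtain J :: "nat set" and L where J: "finite J" "\<forall>j\<in>J. lattice_line (L j)"
      "covers 4 J L (region (grid_bounds n))" "card J = size M" using is_k_cover_covers[OF M] .
    have "3 * int 2 * (1 - (\<Sum>i<3. grid_bounds n i)) \<le> 2 * int (card J)"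
      by (rule lower_bound_even[OF _ J(1,2) _ le]) (use J(3) in simp_all)
    then show ?thesis unfolding sum_grid_bounds J(4) by simp
  qed
qed

section \<open>Covers by lines parallel to the sides\<close>

definition axis_lines :: "nat \<Rightarrow> nat \<Rightarrow> nat \<Rightarrow> nat \<Rightarrow> ((nat \<Rightarrow> real) \<times> real) multiset" where
  "axis_lines n a b c =
     image_mset (\<lambda>i. ((\<lambda>j. if j = 0 then 1 else 0), real i)) (mset_set {..<a}) +
     image_mset (\<lambda>i. ((\<lambda>j. if j = 1 then 1 else 0), real i)) (mset_set {..<b}) +
     image_mset (\<lambda>i. ((\<lambda>j. if j < 2 then 1 else 0), real n - 1 - real i)) (mset_set {..<c})"

lemma size_axis_lines [simp]: "size (axis_lines n a b c) = a + b + c"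
  by (simp add: axis_lines_def)

lemma is_hyperplane_axis_lines: "H \<in># axis_lines n a b c \<Longrightarrow> is_hyperplane 2 H"
  by (auto simp: axis_lines_def is_hyperplane_def less_2_cases_iff)

lemma size_filter_image_mset_ge:
  fixes i a :: nat
  assumes "i < a \<Longrightarrow> \<phi> (h i)"
  shows "of_bool (i < a) \<le> size (filter_mset \<phi> (image_mset h (mset_set {..<a})))"
proof (cases "i < a")
  case True
  then have "h i \<in># filter_mset \<phi> (image_mset h (mset_set {..<a}))" using assms by auto
  then have "filter_mset \<phi> (image_mset h (mset_set {..<a})) \<noteq> {#}" by force
  then have "0 < size (filter_mset \<phi> (image_mset h (mset_set {..<a})))"
    unfolding nonempty_has_size .
  then show ?thesis using True by (simp only: of_bool_eq)
qed simp

text \<open>The numbers \<open>y 0\<close>, \<open>y 1\<close>, \<open>z\<close> are the depths of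
  the point below the three sides; each family contains the line through the point if its depth is
  small enough.\<close>

lemma axis_lines_through_point:
  assumes "\<And>i. v i = real (y i)" "y 0 + y 1 + z + 1 = n"
  shows "of_bool (y 0 < a) + of_bool (y 1 < b) + of_bool (z < c)
    \<le> size (filter_mset (on_hyperplane 2 v) (axis_lines n a b c))"
  unfolding axis_lines_def filter_union_mset size_union
  by (intro add_mono size_filter_image_mset_ge)
    (use assms in \<open>auto simp: on_hyperplane_def sum_less_2\<close>)

lemma is_k_cover_axis_lines:
  assumes "\<And>x y z. x + y + z + 1 = n \<Longrightarrow>
    k \<le> of_bool (x < a) + of_bool (y < b) + of_bool (z < c)
      + (of_bool (x < a') + of_bool (y < b') + of_bool (z < c'))"
  shows "is_k_cover n 2 k (axis_lines n a b c + axis_lines n a' b' c')"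
  unfolding is_k_cover_def
proof (intro conjI ballI)
  fix v assume "v \<in> tri_grid n 2"
  then obtain y :: "nat \<Rightarrow> nat" where y: "\<And>i. v i = real (y i)" "y 0 + y 1 + 1 \<le> n"
    by (auto simp: tri_grid_def sum_less_2)
  then obtain z where z: "y 0 + y 1 + z + 1 = n" using that by (metis add.assoc add.commute le_Suc_ex)
  show "k \<le> size (filter_mset (on_hyperplane 2 v) (axis_lines n a b c + axis_lines n a' b' c'))"
    using order_trans[OF assms[OF z] add_mono[OF axis_lines_through_point axis_lines_through_point]]
      y(1) z by (simp del: of_bool_less_eq_iff)
qed (auto dest: is_hyperplane_axis_lines)

text \<open>Every cover has at least \<open>s / r\<close> lines, and \<open>r * m < s + r\<close>
  says that \<open>m\<close> does not exceed this bound rounded up.\<close>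

lemma f_cover_eqI:
  assumes "is_k_cover n 2 k M" "size M = m" "r * m < s + r"
    and "\<And>M. is_k_cover n 2 k M \<Longrightarrow> s \<le> r * size M"
  shows "f_cover n 2 k = m"
  unfolding f_cover_def
proof (rule Least_equality)
  show "\<exists>M. is_k_cover n 2 k M \<and> size M = m" using assms(1,2) by blast
  fix l assume "\<exists>M. is_k_cover n 2 k M \<and> size M = l"
  then have "r * m < r * (l + 1)" using assms(3,4) by fastforce
  then have "m < l + 1" unfolding mult_less_cancel1 by simp
  then show "m \<le> l" by simp
qed

theorem mainTheorem3:
  fixes n :: nat
  assumes "n \<ge> 2"
  shows "f_cover n 2 1 = n \<and>
         int (f_cover n 2 2) = \<lceil>3 * real n / 2\<rceil> \<and>
         int (f_cover n 2 3) = \<lceil>9 * real n / 4\<rceil> \<and>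
         f_cover n 2 4 = 3 * n"
proof (intro conjI)
  \<comment> \<open>The depths are \<open>n / 2\<close> rounded down and up, and
    \<open>n / 4\<close> rounded down, to the nearest integer and up.\<close>
  define h h' where "h = n div 2" and "h' = (n + 1) div 2"
  define q1 q2 q3 where "q1 = n div 4" and "q2 = (n + 2) div 4" and "q3 = (n + 3) div 4"
  have h: "h + h' = n" "h \<le> h'" "h' \<le> h + 1" unfolding h_def h'_def by presburger+
  have q: "q1 + q2 + h' \<ge> n" "q1 + q3 + h' \<ge> n" "q2 + q3 + h \<ge> n" "q1 \<le> h" "q2 \<le> h'" "q3 \<le> h'"
    unfolding h_def h'_def q1_def q2_def q3_def by presburger+
  have "is_k_cover n 2 1 (axis_lines n n 0 0 + axis_lines n 0 0 0)"
    by (rule is_k_cover_axis_lines) auto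
  then show "f_cover n 2 1 = n"
    by (rule f_cover_eqI[where r = 1 and s = n]) (use cover_lower_bounds(1) in auto)
  \<comment> \<open>Any two of the depths sum to at least \<open>n\<close>, so a point fails at most
    one of the three tests.\<close>
  have "is_k_cover n 2 2 (axis_lines n h h' h' + axis_lines n 0 0 0)"
    by (rule is_k_cover_axis_lines) (use h in \<open>auto simp: of_bool_def\<close>)
  then have "f_cover n 2 2 = h + h' + h'"
    by (rule f_cover_eqI[where r = 2 and s = "3 * n"]) (use h cover_lower_bounds(2) in auto)
  then have "3 * n \<le> 2 * f_cover n 2 2" "2 * f_cover n 2 2 \<le> 3 * n + 1" using h by auto
  then show "int (f_cover n 2 2) = \<lceil>3 * real n / 2\<rceil>" by linarith
  have "is_k_cover n 2 3 (axis_lines n h h' h' + axis_lines n q1 q2 q3)"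
  proof (rule is_k_cover_axis_lines)
    \<comment> \<open>With four failed tests, either two coordinates fail both of theirs, or one
      fails both and the others fail against the \<open>q\<close> depths. By \<open>h\<close> and
      the first three inequalities in \<open>q\<close> the coordinates would then sum to at least
      \<open>n\<close>.\<close>
    show "3 \<le> of_bool (x < h) + of_bool (y < h') + of_bool (z < h')
      + (of_bool (x < q1) + of_bool (y < q2) + (of_bool (z < q3) :: nat))" if "x + y + z + 1 = n" for x y z
      using that h q
      by (cases "x < q1"; cases "y < q2"; cases "z < q3"; cases "x < h"; cases "y < h'"; cases "z < h'";
        simp only: of_bool_eq simp_thms; linarith)
  qed
  moreover have size: "4 * (h + h' + h' + (q1 + q2 + q3)) \<le> 9 * n + 3"
  proof -
    define m where "m = n div 4"
    consider "n = 4 * m" | "n = 4 * m + 1" | "n = 4 * m + 2" | "n = 4 * m + 3"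
      unfolding m_def by linarith
    then show ?thesis
      by (cases; simp add: h_def h'_def q1_def q2_def q3_def; (presburger)?)
  qed
  ultimately have "f_cover n 2 3 = h + h' + h' + (q1 + q2 + q3)"
    by (intro f_cover_eqI[where r = 4 and s = "9 * n"]) (use cover_lower_bounds(3) in auto)
  moreover have "9 * n \<le> 4 * (h + h' + h' + (q1 + q2 + q3))"
    using h q unfolding distrib_left by linarith
  ultimately have "9 * n \<le> 4 * f_cover n 2 3" "4 * f_cover n 2 3 \<le> 9 * n + 3" using size by simp_all
  then show "int (f_cover n 2 3) = \<lceil>9 * real n / 4\<rceil>" by linarith
  \<comment> \<open>Three failed tests would need all coordinates at least \<open>h\<close>, or one
    at least \<open>h'\<close> and another at least \<open>h\<close>. Both \<open>3 * h\<close> and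
    \<open>h + h'\<close> are at least \<open>n\<close>, the former because
    \<open>n \<ge> 2\<close>.\<close>
  have "is_k_cover n 2 4 (axis_lines n h h h + axis_lines n h' h' h')"
    by (rule is_k_cover_axis_lines) (use h assms in \<open>auto simp: of_bool_def\<close>)
  then show "f_cover n 2 4 = 3 * n"
    by (rule f_cover_eqI[where r = 1 and s = "3 * n"]) (use h cover_lower_bounds(4) in auto)
qed

end
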